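(* Let $m,n$ be positive integers and, for $0\le k\le\min\{m,n\}$, let $F_k=\{T\in B(\mathbf{R}^m,\mathbf{R}^n):\operatorname{rank}T=k\}$. Then $$B(\mathbf{R}^m,\mathbf{R}^n)=\bigcup_{k=0}^{\min\{n,m\}}F_k,$$ each $F_k$ with $k<\min\{m,n\}$ is a smooth and path connected submanifold of $B(\mathbf{R}^m,\mathbf{R}^n)$, and $$\dim F_k=(m+n-k)k\qquad\text{for } k=0,1,\dots,\min\{n,m\}.$$
   Context: $B(\mathbf{R}^m,\mathbf{R}^n)$ denotes the (finite-dimensional normed) space of all linear operators from $\mathbf{R}^m$ to $\mathbf{R}^n$. A set $S\subset B(\mathbf{R}^m,\mathbf{R}^n)$ is said to be path connected if for any two operators $T_0,T_1\in S$ there is a continuous path $\omega(t)\in S$, $t\in[0,1]$, with $\omega(0)=T_0$ and $\omega(1)=T_1$. $\dim F_k$ denotes the dimension of $F_k$ as a smooth manifold. *)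

theory Defs
  imports "HOL-Analysis.Analysis"
begin

text \<open>
  The class \<open>C\<^sup>n\<close> on an open set. Higher derivatives are expressed through the directional
  maps \<open>x \<mapsto> f'(x) v\<close>, so that the type of \<open>f\<close> stays the same in the recursion. If the domain is
  finite-dimensional, requiring these maps to be \<open>C\<^sup>n\<close> for every \<open>v\<close> is the same as requiring
  the operator-valued map \<open>f'\<close> to be \<open>C\<^sup>n\<close>.
\<close>

primrec C_diff_on :: "nat \<Rightarrow> 'a set \<Rightarrow> ('a::real_normed_vector \<Rightarrow> 'b::real_normed_vector) \<Rightarrow> bool"
where
  "C_diff_on 0 U f \<longleftrightarrow> continuous_on U f"
| "C_diff_on (Suc n) U f \<longleftrightarrow>
     (\<forall>x\<in>U. f differentiable (at x)) \<and>
     (\<forall>v. C_diff_on n U (\<lambda>x. frechet_derivative f (at x) v))"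

definition smooth_on :: "'a set \<Rightarrow> ('a::real_normed_vector \<Rightarrow> 'b::real_normed_vector) \<Rightarrow> bool"
where
  "smooth_on U f \<longleftrightarrow> (\<forall>n. C_diff_on n U f)"

definition diffeomorphism ::
  "'a set \<Rightarrow> 'b set \<Rightarrow> ('a::real_normed_vector \<Rightarrow> 'b::real_normed_vector) \<Rightarrow> ('b \<Rightarrow> 'a) \<Rightarrow> bool"
where
  "diffeomorphism U V \<phi> \<psi> \<longleftrightarrow>
     open U \<and> open V \<and> homeomorphism U V \<phi> \<psi> \<and> smooth_on U \<phi> \<and> smooth_on V \<psi>"

text \<open>
  Near \<open>x\<close>, a chart of the ambient space flattens \<open>S\<close> onto the linear subspace \<open>E\<close>.
  Finite-dimensionality of \<open>E\<close> is made explicit because \<^const>\<open>dim\<close> is \<open>0\<close> on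
  infinite-dimensional subspaces; it holds automatically in a finite-dimensional ambient space.
\<close>

definition smooth_slice_at :: "'a::real_normed_vector set \<Rightarrow> 'a \<Rightarrow> 'a set \<Rightarrow> bool"
where
  "smooth_slice_at S x E \<longleftrightarrow>
     subspace E \<and> (\<exists>B. finite B \<and> E = span B) \<and>
     (\<exists>U V \<phi> \<psi>. x \<in> U \<and> diffeomorphism U V \<phi> \<psi> \<and> \<phi> ` (S \<inter> U) = E \<inter> V)"

definition smooth_submanifold :: "'a::real_normed_vector set \<Rightarrow> bool"
where
  "smooth_submanifold S \<longleftrightarrow> (\<forall>x\<in>S. \<exists>E. smooth_slice_at S x E)"

text \<open>
  \<open>S\<close> is a smooth submanifold all of whose charts are modelled on \<open>d\<close>-dimensional spaces.
  The empty set is excluded: it would have every dimension.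
\<close>

definition has_manifold_dim :: "'a::real_normed_vector set \<Rightarrow> nat \<Rightarrow> bool"
where
  "has_manifold_dim S d \<longleftrightarrow> S \<noteq> {} \<and> (\<forall>x\<in>S. \<exists>E. smooth_slice_at S x E \<and> dim E = d)"

definition op_rank :: "('a::euclidean_space \<Rightarrow>\<^sub>L 'b::euclidean_space) \<Rightarrow> nat"
where
  "op_rank T = dim (range (blinfun_apply T))"

definition fixed_rank :: "nat \<Rightarrow> ((real^'m) \<Rightarrow>\<^sub>L (real^'n)) set"
where
  "fixed_rank k = {T. op_rank T = k}"

end

theory Submission
  imports Defs
begin

text \<open>
  Let \<open>T0\<close> have rank \<open>k\<close>, let \<open>A\<close> be a generalized inverse of \<open>T0\<close>
  (\<open>T0 A T0 = T0\<close>, \<open>A T0 A = A\<close>), and put \<open>D T = I + (T - T0) A\<close>, which is invertible for \<open>T\<close>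
  near \<open>T0\<close>. Since \<open>D T \<circ> T0 = T A T0\<close>, the operator \<open>D T\<close> carries the range of \<open>T0\<close> onto a
  \<open>k\<close>-dimensional subspace of the range of \<open>T\<close>. Hence \<open>T\<close> has rank \<open>k\<close> iff that subspace is the
  whole range of \<open>T\<close>, that is, iff \<open>(D T)\<inverse> T\<close> maps the kernel of \<open>T0\<close> into the range of \<open>T0\<close>
  (\<open>op_rank_eq_iff\<close>). With \<open>Q = T0 A\<close> and \<open>P = A T0\<close> the map
  \<open>\<phi> T = T + (I - Q) (D T)\<inverse> Q T (I - P)\<close> turns this condition into the linear one
  \<open>\<phi> T (ker T0) \<subseteq> range T0\<close>. The correction term depends only on \<open>T A\<close> and \<open>Q T\<close>, and adding it
  changes neither, so subtracting it inverts \<open>\<phi>\<close>. Thus \<open>\<phi>\<close> is a slice chart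
  (\<open>smooth_slice_op_rank\<close>); its smoothness comes down to that of operator inversion
  (\<open>smooth_on_inverse\<close>).

  The model space \<open>{W. W (ker T0) \<subseteq> range T0}\<close> has a basis of rank-one operators built from
  orthonormal bases adapted to \<open>ker T0\<close> and \<open>range T0\<close>. Of the \<open>m n\<close> such operators exactly the
  \<open>(m - k) (n - k)\<close> from the kernel to the complement of the range are missing, which leaves
  \<open>(m + n - k) k\<close>.

  For path connectedness let \<open>k < m\<close> and \<open>k < n\<close>. Two operators of rank \<open>k\<close> are related by
  \<open>H S = T G\<close> with \<open>H\<close> and \<open>G\<close> invertible, so it is enough to join \<open>H S\<close> to \<open>S\<close> and \<open>T G\<close> to \<open>T\<close>
  inside the operators of rank \<open>k\<close>. As \<open>H\<close> is a product of invertible maps that fix a hyperplane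
  pointwise, let it be one of them. Because \<open>k < n\<close>, a straight line of rank \<open>k\<close> operators moves
  \<open>S\<close> to some \<open>S'\<close> with range inside that hyperplane. Then \<open>H S' = S'\<close>, and applying \<open>H\<close> to the
  line joins \<open>H S\<close> to the same \<open>S'\<close>. The same device works on the right when \<open>k < m\<close>. The
  spare dimension thus absorbs orientation-reversing factors, which could not be joined to the
  identity among invertible maps.
\<close>

section \<open>Differentiability classes\<close>

lemma C_diff_on_cong:
  assumes "open U" "\<And>x. x \<in> U \<Longrightarrow> f x = g x" "C_diff_on n U f"
  shows "C_diff_on n U g"
  using assms(2,3)
proof (induction n arbitrary: f g)
  case 0
  then show ?case
    using continuous_on_cong[of U U f g] by auto
next
  case (Suc n)
  have g': "(g has_derivative frechet_derivative f (at x)) (at x)" if "x \<in> U" for x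
  proof (rule has_derivative_transform_within_open[OF _ assms(1) that])
    show "(f has_derivative frechet_derivative f (at x)) (at x)"
      using Suc.prems(2) that by (auto simp: frechet_derivative_works)
  qed (use Suc.prems(1) in auto)
  then have "frechet_derivative f (at x) = frechet_derivative g (at x)" if "x \<in> U" for x
    using that frechet_derivative_at by blast
  then have "C_diff_on n U (\<lambda>x. frechet_derivative g (at x) v)" for v
    using Suc.IH[of "\<lambda>x. frechet_derivative f (at x) v" "\<lambda>x. frechet_derivative g (at x) v"]
      Suc.prems(2) by simp
  moreover have "g differentiable (at x)" if "x \<in> U" for x
    using g'[OF that] by (rule differentiableI)
  ultimately show ?case by simp
qed

text \<open>
  The recursive definition asks about \<^const>\<open>frechet_derivative\<close>; this rule lets one supply any
  explicit formula for the derivative instead.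
\<close>

lemma C_diff_on_Suc_has_derivative:
  assumes "open U" and f': "\<And>x. x \<in> U \<Longrightarrow> (f has_derivative f' x) (at x)"
    and C: "\<And>v. C_diff_on n U (\<lambda>x. f' x v)"
  shows "C_diff_on (Suc n) U f"
proof -
  have "f' x = frechet_derivative f (at x)" if "x \<in> U" for x
    using f'[OF that] frechet_derivative_at by blast
  then have "C_diff_on n U (\<lambda>x. frechet_derivative f (at x) v)" for v
    using C_diff_on_cong[OF assms(1) _ C[of v]] by simp
  moreover have "f differentiable (at x)" if "x \<in> U" for x
    using f'[OF that] by (rule differentiableI)
  ultimately show ?thesis by simp
qed

lemma C_diff_on_Suc_imp:
  "C_diff_on (Suc n) U f \<Longrightarrow> C_diff_on n U f"
proof (induction n arbitrary: f)
  case 0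
  then have "isCont f x" if "x \<in> U" for x
    using that differentiable_imp_continuous_within[of f x UNIV] by simp
  then show ?case
    by (simp add: continuous_at_imp_continuous_on)
next
  case (Suc n)
  then show ?case
    unfolding C_diff_on.simps(2)[of "Suc n"] C_diff_on.simps(2)[of n U f] by blast
qed

lemma C_diff_on_const: "open U \<Longrightarrow> C_diff_on n U (\<lambda>x. c)"
proof (induction n arbitrary: c)
  case (Suc n)
  show ?case
    using Suc by (intro C_diff_on_Suc_has_derivative[where f' = "\<lambda>_ _. 0"]) simp_all
qed simp

lemma C_diff_on_bounded_linear:
  assumes "open U" "bounded_linear L"
  shows "C_diff_on n U L"
proof (cases n)
  case 0
  then show ?thesis using assms by (simp add: linear_continuous_on)
next
  case (Suc k)
  show ?thesis
    unfolding Suc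
    by (rule C_diff_on_Suc_has_derivative[OF assms(1), where f' = "\<lambda>_. L"])
      (simp_all add: assms bounded_linear_imp_has_derivative C_diff_on_const)
qed

lemma C_diff_on_SucD:
  assumes "C_diff_on (Suc n) U f"
  shows "x \<in> U \<Longrightarrow> (f has_derivative frechet_derivative f (at x)) (at x)"
    and "C_diff_on n U (\<lambda>x. frechet_derivative f (at x) v)"
  using assms by (simp_all add: frechet_derivative_works)

lemma C_diff_on_add:
  assumes "open U"
  shows "C_diff_on n U f \<Longrightarrow> C_diff_on n U g \<Longrightarrow> C_diff_on n U (\<lambda>x. f x + g x)"
proof (induction n arbitrary: f g)
  case 0
  then show ?case by (simp add: continuous_on_add)
next
  case (Suc n)
  note D = C_diff_on_SucD[OF Suc.prems(1)] C_diff_on_SucD[OF Suc.prems(2)]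
  show ?case
    by (rule C_diff_on_Suc_has_derivative[OF assms has_derivative_add[OF D(1) D(3)]])
      (use D Suc.IH in auto)
qed

text \<open>
  By the product rule the derivative is a sum of two products of the same kind, so induction
  applies. The undifferentiated factors have to be of class \<open>C\<^sup>n\<close> as well, which is
  \<open>C_diff_on_Suc_imp\<close>.
\<close>

lemma C_diff_on_bilinear:
  assumes "open U" "bounded_bilinear bop"
  shows "C_diff_on n U f \<Longrightarrow> C_diff_on n U g \<Longrightarrow> C_diff_on n U (\<lambda>x. bop (f x) (g x))"
proof (induction n arbitrary: f g)
  case 0
  then show ?case
    by (simp add: bounded_bilinear.continuous_on[OF assms(2)])
next
  case (Suc n)
  note D = C_diff_on_SucD[OF Suc.prems(1)] C_diff_on_SucD[OF Suc.prems(2)]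
  note fg = C_diff_on_Suc_imp[OF Suc.prems(1)] C_diff_on_Suc_imp[OF Suc.prems(2)]
  show ?case
    by (rule C_diff_on_Suc_has_derivative[OF assms(1)
          bounded_bilinear.FDERIV[OF assms(2) D(1) D(3)]])
      (simp_all add: C_diff_on_add[OF assms(1)] Suc.IH D fg)
qed

lemma blinfun_compose_diff_left: "(a - b) o\<^sub>L c = (a o\<^sub>L c) - (b o\<^sub>L c)"
  by (rule blinfun_eqI) (simp add: blinfun.bilinear_simps)

lemma norm_blinfun_compose3: "norm (a o\<^sub>L b o\<^sub>L c) \<le> norm a * norm b * norm c"
  by (meson mult_right_mono norm_blinfun_compose norm_ge_zero order_trans)

text \<open>
  The resolvent identity \<open>G y - G x = - G y (D y - D x) G x\<close> gives continuity from the bound on \<open>G\<close>,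
  and then the derivative \<open>v \<mapsto> - G x (L v) G x\<close>. The latter is a product of copies of \<open>G\<close> with a
  constant, so if \<open>G\<close> is of class \<open>C\<^sup>n\<close> it is of class \<open>C\<^bsup>n+1\<^esup>\<close>. Only an affine family \<open>D\<close> is
  considered, since this is how operator inversion enters the chart.
\<close>

lemma smooth_on_inverse:
  fixes D :: "'a::real_normed_vector \<Rightarrow> 'b::real_normed_vector \<Rightarrow>\<^sub>L 'b"
  assumes "open U" and L: "bounded_linear L"
    and D: "\<And>x y. x \<in> U \<Longrightarrow> y \<in> U \<Longrightarrow> D y - D x = L (y - x)"
    and GD: "\<And>x. x \<in> U \<Longrightarrow> G x o\<^sub>L D x = id_blinfun"
    and DG: "\<And>x. x \<in> U \<Longrightarrow> D x o\<^sub>L G x = id_blinfun"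
    and M: "\<And>x. x \<in> U \<Longrightarrow> norm (G x) \<le> M"
  shows "smooth_on U G"
proof -
  interpret L: bounded_linear L by fact
  have resolvent: "G y - G x = - (G y o\<^sub>L L (y - x) o\<^sub>L G x)" if "x \<in> U" "y \<in> U" for x y
  proof (rule blinfun_eqI)
    fix i
    have "G y (D y (G x i)) = G x i" "D x (G x i) = i"
      using GD[OF that(2)] DG[OF that(1)]
      by (metis blinfun_apply_blinfun_compose blinfun_apply_id_blinfun)+
    then show "blinfun_apply (G y - G x) i = blinfun_apply (- (G y o\<^sub>L L (y - x) o\<^sub>L G x)) i"
      by (simp add: D[OF that, symmetric] blinfun.bilinear_simps)
  qed
  have M0: "0 \<le> M" if "x \<in> U" for x
    using M[OF that] norm_ge_zero order_trans by blast
  have cont: "isCont G x" if x: "x \<in> U" for x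
  proof -
    have "((\<lambda>y. G y - G x) \<longlongrightarrow> 0) (at x)"
    proof (rule Lim_null_comparison)
      have "norm (G y - G x) \<le> M * norm (L (y - x)) * M" if "y \<in> U" for y
      proof -
        have "norm (G y - G x) \<le> norm (G y) * norm (L (y - x)) * norm (G x)"
          unfolding resolvent[OF x that] norm_minus_cancel by (rule norm_blinfun_compose3)
        also have "\<dots> \<le> M * norm (L (y - x)) * M"
          using M x that M0[OF x] by (intro mult_mono) auto
        finally show ?thesis .
      qed
      then show "\<forall>\<^sub>F y in at x. norm (G y - G x) \<le> M * norm (L (y - x)) * M"
        using eventually_at_topological assms(1) x by blast
      have "((\<lambda>y. M * norm (L (y - x)) * M) \<longlongrightarrow> M * norm (L (x - x)) * M) (at x)"
        by (intro tendsto_intros L.tendsto)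
      then show "((\<lambda>y. M * norm (L (y - x)) * M) \<longlongrightarrow> 0) (at x)"
        by (simp add: L.zero)
    qed
    then show ?thesis by (simp add: LIM_zero_iff isCont_def)
  qed
  have deriv: "(G has_derivative (\<lambda>v. - (G x o\<^sub>L L v o\<^sub>L G x))) (at x)" if x: "x \<in> U" for x
    unfolding has_derivative_iff_norm
  proof
    show "bounded_linear (\<lambda>v. - (G x o\<^sub>L L v o\<^sub>L G x))"
      by (intro bounded_linear_minus
          bounded_linear_compose[OF bounded_bilinear.bounded_linear_left[OF bounded_bilinear_blinfun_compose]]
          bounded_linear_compose[OF bounded_bilinear.bounded_linear_right[OF bounded_bilinear_blinfun_compose]] L)
    obtain K where K: "\<And>z. norm (L z) \<le> norm z * K" "K \<ge> 0"
      using L.nonneg_bounded by blast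
    show "((\<lambda>y. norm (G y - G x - - (G x o\<^sub>L L (y - x) o\<^sub>L G x)) / norm (y - x)) \<longlongrightarrow> 0) (at x)"
    proof (rule Lim_null_comparison)
      have "norm (norm (G y - G x - - (G x o\<^sub>L L (y - x) o\<^sub>L G x)) / norm (y - x))
              \<le> norm (G y - G x) * K * M" if "y \<in> U" "y \<noteq> x" for y
      proof -
        have "G y - G x - - (G x o\<^sub>L L (y - x) o\<^sub>L G x) = - ((G y - G x) o\<^sub>L L (y - x) o\<^sub>L G x)"
          by (subst resolvent[OF x that(1)]) (simp add: blinfun_compose_diff_left)
        then have "norm (G y - G x - - (G x o\<^sub>L L (y - x) o\<^sub>L G x))
                   \<le> norm (G y - G x) * norm (L (y - x)) * norm (G x)"
          by (simp only: norm_minus_cancel norm_blinfun_compose3)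
        also have "\<dots> \<le> norm (G y - G x) * (norm (y - x) * K) * M"
          using M[OF x] K by (intro mult_mono) auto
        finally show ?thesis using that by (simp add: divide_le_eq mult.assoc mult.left_commute mult.commute)
      qed
      then show "\<forall>\<^sub>F y in at x. norm (norm (G y - G x - - (G x o\<^sub>L L (y - x) o\<^sub>L G x)) / norm (y - x))
              \<le> norm (G y - G x) * K * M"
        using eventually_at_topological assms(1) x by blast
      have "((\<lambda>y. norm (G y - G x) * K * M) \<longlongrightarrow> norm (G x - G x) * K * M) (at x)"
        using cont[OF x] by (intro tendsto_intros) (simp add: isCont_def)
      then show "((\<lambda>y. norm (G y - G x) * K * M) \<longlongrightarrow> 0) (at x)" by simp
    qed
  qed
  have "C_diff_on n U G" for n
  proof (induction n)
    case 0
    then show ?case using cont by (simp add: continuous_at_imp_continuous_on)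
  next
    case (Suc n)
    have "C_diff_on n U (\<lambda>x. - (G x o\<^sub>L L v o\<^sub>L G x))" for v
    proof -
      have "C_diff_on n U (\<lambda>x. (G x o\<^sub>L - L v) o\<^sub>L G x)"
        using Suc assms(1)
        by (intro C_diff_on_bilinear[OF _ bounded_bilinear_blinfun_compose] C_diff_on_const)
      moreover have "(G x o\<^sub>L - L v) o\<^sub>L G x = - (G x o\<^sub>L L v o\<^sub>L G x)" for x
        by (rule blinfun_eqI) (simp add: blinfun.bilinear_simps)
      ultimately show ?thesis by simp
    qed
    then show ?case
      using assms(1) deriv by (intro C_diff_on_Suc_has_derivative)
  qed
  then show ?thesis by (simp add: smooth_on_def)
qed

text \<open>
  The lower bound \<open>norm x \<le> 2 * norm (D x)\<close> makes \<open>D\<close> injective, hence bijective in finite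
  dimensions, and it bounds the inverse uniformly as \<open>smooth_on_inverse\<close>
  requires.
\<close>

lemma blinfun_inverse_near_id:
  fixes D :: "'a::euclidean_space \<Rightarrow>\<^sub>L 'a"
  assumes "norm (D - id_blinfun) < 1/2"
  shows "\<exists>G. G o\<^sub>L D = id_blinfun \<and> D o\<^sub>L G = id_blinfun \<and> norm G \<le> 2"
proof -
  have lower: "norm x \<le> 2 * norm (D x)" for x
  proof -
    have "norm ((D - id_blinfun) x) \<le> 1/2 * norm x"
      using assms norm_blinfun[of "D - id_blinfun" x]
      by (meson less_imp_le mult_right_mono norm_ge_zero order_trans)
    then show ?thesis
      using norm_triangle_ineq2[of x "D x"] by (simp add: blinfun.bilinear_simps norm_minus_commute)
  qed
  have lin: "linear (blinfun_apply D)"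
    by (simp add: blinfun.bounded_linear_right bounded_linear.linear)
  have "inj (blinfun_apply D)"
  proof (rule injI)
    fix x y assume "D x = D y"
    then show "x = y" using lower[of "x - y"] by (simp add: blinfun.bilinear_simps)
  qed
  then obtain g where g: "linear g" "\<And>x. g (D x) = x" "\<And>x. D (g x) = x"
    using linear_injective_isomorphism[OF lin] by auto
  have ap: "blinfun_apply (Blinfun g) = g"
    using g(1) by (simp add: bounded_linear_Blinfun_apply linear_conv_bounded_linear)
  have "norm (Blinfun g) \<le> 2"
    using lower[of "g _"] by (intro norm_blinfun_bound) (auto simp: ap g)
  then show ?thesis
    by (intro exI[of _ "Blinfun g"]) (auto intro!: blinfun_eqI simp: ap g)
qed

section \<open>The slice chart at an operator\<close>

lemma linear_blinfun_apply: "linear (blinfun_apply T)"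
  by (simp add: blinfun.bounded_linear_right bounded_linear.linear)

lemma blinfun_apply_Blinfun_linear:
  fixes f :: "'a::euclidean_space \<Rightarrow> 'b::real_normed_vector"
  shows "linear f \<Longrightarrow> blinfun_apply (Blinfun f) = f"
  by (simp add: bounded_linear_Blinfun_apply linear_conv_bounded_linear)

text \<open>
  A linear right inverse \<open>g\<close> of \<open>T\<close> on its range satisfies the first equation; \<open>g T g\<close>
  satisfies both.
\<close>

lemma generalized_inverse_exists:
  fixes T :: "'a::euclidean_space \<Rightarrow>\<^sub>L 'b::euclidean_space"
  obtains A :: "'b \<Rightarrow>\<^sub>L 'a"
  where "\<And>x. T (A (T x)) = T x" "\<And>y. A (T (A y)) = A y"
proof -
  obtain g where g: "linear g" "\<And>v. v \<in> range T \<Longrightarrow> T (g v) = v"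
    using linear_exists_right_inverse_on[OF linear_blinfun_apply[of T] subspace_UNIV] by auto
  define A where "A = Blinfun (\<lambda>y. g (T (g y)))"
  have lin: "linear (\<lambda>y. g (T (g y)))"
    using linear_compose[OF linear_compose[OF g(1) linear_blinfun_apply[of T]] g(1)]
    by (simp add: o_def)
  have A: "A y = g (T (g y))" for y
    unfolding A_def blinfun_apply_Blinfun_linear[OF lin] ..
  show ?thesis
    by (rule that[of A]) (simp_all add: A g(2))
qed

text \<open>
  The identity \<open>D T0 = T A T0\<close> shows that the injective \<open>D\<close> maps \<open>range T0\<close> into \<open>range T\<close>, so the
  ranks agree iff \<open>D\<close> maps it onto \<open>range T\<close>. Every vector differs from one in the range of \<open>A T0\<close>,
  where \<open>T\<close> already takes values in \<open>D ` range T0\<close>, by an element of the kernel of \<open>T0\<close>; so only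
  the kernel has to be tested.
\<close>

lemma op_rank_eq_iff:
  fixes T T0 :: "'a::euclidean_space \<Rightarrow>\<^sub>L 'b::euclidean_space"
    and A :: "'b \<Rightarrow>\<^sub>L 'a" and D G :: "'b \<Rightarrow>\<^sub>L 'b"
  assumes A: "\<And>x. T0 (A (T0 x)) = T0 x"
    and D: "D = id_blinfun + ((T - T0) o\<^sub>L A)"
    and GD: "\<And>y. G (D y) = y" and DG: "\<And>y. D (G y) = y"
  shows "op_rank T = op_rank T0 \<longleftrightarrow> (\<forall>x. T0 x = 0 \<longrightarrow> G (T x) \<in> range T0)"
proof -
  have D_T0: "D (T0 x) = T (A (T0 x))" for x
    by (simp add: D blinfun.bilinear_simps A)
  have inj: "inj D"
    by (metis GD injI)
  have dim_D: "dim (D ` range T0) = op_rank T0"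
    unfolding op_rank_def by (intro dim_image_eq linear_blinfun_apply inj_on_subset[OF inj]) auto
  have sub: "D ` range T0 \<subseteq> range T"
    by (auto simp: D_T0)
  have subsp: "subspace (D ` range T0)" "subspace (range T)"
    by (intro linear_subspace_image linear_blinfun_apply subspace_UNIV)+
  have "op_rank T = op_rank T0 \<longleftrightarrow> D ` range T0 = range T"
    using subspace_dim_equal[OF subsp sub] dim_D unfolding op_rank_def by (metis order_refl)
  also have "\<dots> \<longleftrightarrow> (\<forall>x. T0 x = 0 \<longrightarrow> G (T x) \<in> range T0)"
  proof
    assume "D ` range T0 = range T"
    then have "T x \<in> D ` range T0" for x by auto
    then show "\<forall>x. T0 x = 0 \<longrightarrow> G (T x) \<in> range T0"
      by (metis GD imageE)
  next
    assume *: "\<forall>x. T0 x = 0 \<longrightarrow> G (T x) \<in> range T0"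
    have "T x \<in> D ` range T0" for x
    proof -
      have "T0 (x - A (T0 x)) = 0"
        by (simp add: blinfun.bilinear_simps A)
      then have "T (x - A (T0 x)) \<in> D ` range T0"
        using * DG by (metis imageI)
      moreover have "T x = D (T0 x) + T (x - A (T0 x))"
        by (simp add: D_T0 blinfun.bilinear_simps)
      ultimately show ?thesis
        using subspace_add[OF subsp(1)] by (metis imageI rangeI)
    qed
    then show "D ` range T0 = range T" using sub by auto
  qed
  finally show ?thesis .
qed

text \<open>
  This is the tangent space at \<open>T0\<close> of the manifold of operators of the rank of \<open>T0\<close>.
\<close>

definition kernel_to_range :: "('a::real_normed_vector \<Rightarrow>\<^sub>L 'b::real_normed_vector) \<Rightarrow> ('a \<Rightarrow>\<^sub>L 'b) set"
where
  "kernel_to_range T0 = {W. \<forall>x. T0 x = 0 \<longrightarrow> blinfun_apply W x \<in> range T0}"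

text \<open>
  In the notation of the introduction \<open>K = I - Q\<close>, \<open>M = I - P\<close> and \<open>g\<close> is the correction term of
  the chart. The maps \<open>T \<mapsto> T + s g T\<close> are studied for all real \<open>s\<close> together: \<open>g\<close> is invariant under
  each of them, so they form a one-parameter group on \<open>U\<close>, with the chart at \<open>s = 1\<close> and its
  inverse at \<open>s = -1\<close>.
\<close>

lemma smooth_slice_op_rank:
  fixes T0 :: "'a::euclidean_space \<Rightarrow>\<^sub>L 'b::euclidean_space"
  assumes "finite B" "kernel_to_range T0 = span B"
  shows "smooth_slice_at {T. op_rank T = op_rank T0} T0 (kernel_to_range T0)"
proof -
  obtain A :: "'b \<Rightarrow>\<^sub>L 'a" where A: "\<And>x. T0 (A (T0 x)) = T0 x" "\<And>y. A (T0 (A y)) = A y"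
    using generalized_inverse_exists by blast
  obtain H :: "('b \<Rightarrow>\<^sub>L 'b) \<Rightarrow> ('b \<Rightarrow>\<^sub>L 'b)" where
    H: "H D o\<^sub>L D = id_blinfun" "D o\<^sub>L H D = id_blinfun" "norm (H D) \<le> 2"
      if "norm (D - id_blinfun) < 1/2" for D
    using blinfun_inverse_near_id by metis
  define D where "D T = id_blinfun + ((T - T0) o\<^sub>L A)" for T
  define U where "U = {T. norm (D T - id_blinfun) < 1/2}"
  define G where "G T = H (D T)" for T
  define K where "K = id_blinfun - (T0 o\<^sub>L A)"
  define M where "M = id_blinfun - (A o\<^sub>L T0)"
  define g where "g T = K o\<^sub>L (G T o\<^sub>L ((T0 o\<^sub>L A) o\<^sub>L (T o\<^sub>L M)))" for T

  have G: "G T o\<^sub>L D T = id_blinfun" "D T o\<^sub>L G T = id_blinfun" "norm (G T) \<le> 2" if "T \<in> U" for T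
    using H that unfolding U_def G_def by auto
  have GD: "G T (D T y) = y" and DG: "D T (G T y) = y" if "T \<in> U" for T y
    using G(1,2)[OF that] by (metis blinfun_apply_blinfun_compose blinfun_apply_id_blinfun)+
  have K_apply: "K y = y - T0 (A y)" for y
    by (simp add: K_def blinfun.bilinear_simps)
  have M_apply: "M x = x - A (T0 x)" for x
    by (simp add: M_def blinfun.bilinear_simps)
  have A_K: "A (K y) = 0" for y
    by (simp add: K_apply blinfun.bilinear_simps A)
  have M_A: "M (A y) = 0" for y
    by (simp add: M_apply A)
  have K_iff: "K y = 0 \<longleftrightarrow> y \<in> range T0" for y
    using A(1) by (auto simp: K_apply blinfun.bilinear_simps)
  have K_K: "K (K y) = K y" for y
    by (simp add: K_apply[of "K y"] A_K blinfun.bilinear_simps)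
  have g_apply: "g T x = K (G T (T0 (A (T (M x)))))" for T x
    by (simp add: g_def)

  \<comment> \<open>Adding a multiple of \<open>g T\<close> leaves \<open>T A\<close> unchanged because \<open>M A = 0\<close>, and \<open>A T\<close> because \<open>A K = 0\<close>.\<close>
  have D_g: "D (T + s *\<^sub>R g T) = D T" for T s
    by (rule blinfun_eqI) (simp add: D_def blinfun.bilinear_simps g_apply M_A)
  have g_g: "g (T + s *\<^sub>R g T) = g T" for T s
  proof (rule blinfun_eqI)
    fix x
    have "A (g T (M x)) = 0" by (simp add: g_apply A_K)
    then show "g (T + s *\<^sub>R g T) x = g T x"
      by (simp add: g_apply[of "T + s *\<^sub>R g T"] g_apply[of T x] G_def D_g blinfun.bilinear_simps)
  qed
  have U_g: "T + s *\<^sub>R g T \<in> U \<longleftrightarrow> T \<in> U" for T s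
    by (simp add: U_def D_g)

  have lin: "bounded_linear (\<lambda>T. T o\<^sub>L A)"
    by (rule bounded_bilinear.bounded_linear_left[OF bounded_bilinear_blinfun_compose])
  have D_diff: "D T - D S = (T - S) o\<^sub>L A" for T S
    by (rule blinfun_eqI) (simp add: D_def blinfun.bilinear_simps)
  have "continuous_on UNIV D"
    unfolding D_def
    by (intro continuous_intros bounded_linear.continuous_on[OF lin])
  then have open_U: "open U"
    unfolding U_def by (intro open_Collect_less continuous_intros)
  have T0_U: "T0 \<in> U"
    by (simp add: U_def D_def)

  have smooth_G: "smooth_on U G"
    using open_U lin D_diff G by (intro smooth_on_inverse[where D = D and M = 2]) auto
  have smooth: "smooth_on U (\<lambda>T. T + s *\<^sub>R g T)" for s
    unfolding smooth_on_def
  proof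
    fix n
    note bil = C_diff_on_bilinear[OF open_U bounded_bilinear_blinfun_compose, of n]
    note const = C_diff_on_const[OF open_U, of n]
    have id: "C_diff_on n U (\<lambda>T. T)"
      by (rule C_diff_on_bounded_linear[OF open_U bounded_linear_ident])
    have "C_diff_on n U g"
      unfolding g_def
      by (intro bil const id) (use smooth_G in \<open>simp add: smooth_on_def\<close>)
    then show "C_diff_on n U (\<lambda>T. T + s *\<^sub>R g T)"
      by (rule C_diff_on_add[OF open_U id
            C_diff_on_bilinear[OF open_U bounded_bilinear_scaleR const]])
  qed
  have cont: "continuous_on U (\<lambda>T. T + s *\<^sub>R g T)" for s
    using smooth[of s] C_diff_on.simps(1) unfolding smooth_on_def by blast

  have inverse: "(T + s *\<^sub>R g T) + (- s) *\<^sub>R g (T + s *\<^sub>R g T) = T" for T s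
    by (simp add: g_g)
  have image: "(\<lambda>T. T + s *\<^sub>R g T) ` U = U" for s
  proof
    show "(\<lambda>T. T + s *\<^sub>R g T) ` U \<subseteq> U" using U_g by blast
    show "U \<subseteq> (\<lambda>T. T + s *\<^sub>R g T) ` U"
    proof
      fix T assume "T \<in> U"
      then have "T + (- s) *\<^sub>R g T \<in> U" using U_g by blast
      moreover have "T = (T + (- s) *\<^sub>R g T) + s *\<^sub>R g (T + (- s) *\<^sub>R g T)"
        using inverse[of T "- s"] by simp
      ultimately show "T \<in> (\<lambda>T. T + s *\<^sub>R g T) ` U" by blast
    qed
  qed
  have "diffeomorphism U U (\<lambda>T. T + s *\<^sub>R g T) (\<lambda>T. T + (- s) *\<^sub>R g T)" for s
    unfolding diffeomorphism_def homeomorphism_def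
    using open_U smooth cont image inverse[of _ s] inverse[of _ "- s"]
    by (intro conjI ballI) (simp_all only: minus_minus)
  then have diffeo: "diffeomorphism U U (\<lambda>T. T + 1 *\<^sub>R g T) (\<lambda>T. T + (- 1) *\<^sub>R g T)" .

  have flat: "T + 1 *\<^sub>R g T \<in> kernel_to_range T0 \<longleftrightarrow> op_rank T = op_rank T0" if T: "T \<in> U" for T
  proof -
    \<comment> \<open>As \<open>D T\<close> fixes the range of \<open>K\<close>, the part \<open>K T\<close> passes through \<open>(D T)\<inverse>\<close> unchanged;
      on the kernel of \<open>T0\<close> the chart therefore agrees with \<open>(D T)\<inverse> T\<close> modulo the range of \<open>T0\<close>.\<close>
    have G_K: "G T (K y) = K y" for y
    proof -
      have "D T (K y) = K y" by (simp add: D_def blinfun.bilinear_simps A_K)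
      then show ?thesis using GD[OF T] by metis
    qed
    have "K ((T + 1 *\<^sub>R g T) x) = K (G T (T x))" if "T0 x = 0" for x
    proof -
      have "K (G T (T x)) = K (G T (T0 (A (T x)) + K (T x)))"
        by (simp add: K_apply)
      also have "\<dots> = K (G T (T0 (A (T x)))) + K (T x)"
        by (simp add: blinfun.bilinear_simps G_K K_K)
      finally show ?thesis
        using that by (simp add: blinfun.bilinear_simps g_apply K_K M_apply)
    qed
    then have "T + 1 *\<^sub>R g T \<in> kernel_to_range T0 \<longleftrightarrow> (\<forall>x. T0 x = 0 \<longrightarrow> G T (T x) \<in> range T0)"
      unfolding kernel_to_range_def K_iff[symmetric] by simp
    also have "\<dots> \<longleftrightarrow> op_rank T = op_rank T0"
      using op_rank_eq_iff[OF A(1) D_def GD[OF T] DG[OF T]] by simp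
    finally show ?thesis .
  qed
  have "(\<lambda>T. T + 1 *\<^sub>R g T) ` ({T. op_rank T = op_rank T0} \<inter> U) = kernel_to_range T0 \<inter> U"
  proof (intro equalityI subsetI)
    fix W assume "W \<in> kernel_to_range T0 \<inter> U"
    then obtain T where "T \<in> U" "W = T + 1 *\<^sub>R g T" using image[of 1] by blast
    then show "W \<in> (\<lambda>T. T + 1 *\<^sub>R g T) ` ({T. op_rank T = op_rank T0} \<inter> U)"
      using flat \<open>W \<in> kernel_to_range T0 \<inter> U\<close> by blast
  qed (use flat U_g[of _ 1] in auto)
  then show ?thesis
    unfolding smooth_slice_at_def using diffeo T0_U assms subspace_span by metis
qed

section \<open>Dimension of the model space\<close>

lemma orthonormal_basis_adapted:
  fixes S :: "'a::euclidean_space set"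
  assumes S: "subspace S"
  obtains B where "finite B" "pairwise orthogonal B" "\<And>x. x \<in> B \<Longrightarrow> norm x = 1"
    "span B = UNIV" "card B = DIM('a)" "card (B \<inter> S) = dim S"
    "\<And>b x. b \<in> B - S \<Longrightarrow> x \<in> S \<Longrightarrow> x \<bullet> b = 0"
proof -
  define S' where "S' = {y. \<forall>x\<in>S. orthogonal x y}"
  have S': "subspace S'"
    unfolding S'_def by (rule subspace_orthogonal_to_vectors)
  have "dim S' + dim S = DIM('a)"
    using dim_subspace_orthogonal_to_vectors[OF S subspace_UNIV] by (simp add: S'_def)
  obtain B1 where B1: "B1 \<subseteq> S" "pairwise orthogonal B1" "\<And>x. x \<in> B1 \<Longrightarrow> norm x = 1"
      "independent B1" "card B1 = dim S" "span B1 = S"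
    using orthonormal_basis_subspace[OF S] by metis
  obtain B2 where B2: "B2 \<subseteq> S'" "pairwise orthogonal B2" "\<And>x. x \<in> B2 \<Longrightarrow> norm x = 1"
      "independent B2" "card B2 = dim S'" "span B2 = S'"
    using orthonormal_basis_subspace[OF S'] by metis
  have fin: "finite B1" "finite B2"
    using B1(4) B2(4) by (auto intro: independent_imp_finite)
  have disj: "B2 \<inter> S = {}"
    using B2(1,3) by (force simp: S'_def orthogonal_def)
  have orth: "pairwise orthogonal (B1 \<union> B2)"
    using B1(1,2) B2(1,2) unfolding pairwise_def S'_def
    by (auto simp: subset_iff) (metis orthogonal_commute)
  have card: "card (B1 \<union> B2) = DIM('a)"
  proof -
    have "B1 \<inter> B2 = {}" using disj B1(1) by blast
    then show ?thesis
      using card_Un_disjoint[OF fin] B1(5) B2(5) \<open>dim S' + dim S = DIM('a)\<close> by simp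
  qed
  have "independent (B1 \<union> B2)"
    using orth B1(3)[of 0] B2(3)[of 0] by (intro pairwise_orthogonal_independent) auto
  then have "span (B1 \<union> B2) = UNIV"
    using card card_ge_dim_independent[of "B1 \<union> B2" UNIV] by (auto simp: dim_UNIV)
  moreover have "(B1 \<union> B2) \<inter> S = B1"
    using disj B1(1) by auto
  moreover have "x \<bullet> b = 0" if "b \<in> B1 \<union> B2 - S" "x \<in> S" for b x
    using that B1(1) B2(1) by (auto simp: S'_def orthogonal_def)
  moreover have "norm b = 1" if "b \<in> B1 \<union> B2" for b
    using that B1(3) B2(3) by blast
  ultimately show ?thesis
    using that[of "B1 \<union> B2"] fin orth card B1(5,6) by simp
qed

text \<open>
  For orthonormal bases \<open>X\<close> and \<open>Y\<close> adapted to \<open>S\<close> and \<open>R\<close>, the rank-one operators \<open>v \<mapsto> (v \<bullet> b) c\<close>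
  with \<open>b \<in> X\<close> and \<open>c \<in> Y\<close> are the matrix units. An operator maps \<open>S\<close> into \<open>R\<close> iff its entries
  in the block \<open>(X \<inter> S) \<times> (Y - R)\<close> vanish, so the other matrix units form a basis.
\<close>

lemma basis_of_operators_between_subspaces:
  fixes S :: "'a::euclidean_space set" and R :: "'b::euclidean_space set"
  assumes S: "subspace S" and R: "subspace R"
  obtains B :: "('a \<Rightarrow>\<^sub>L 'b) set" where "finite B" "independent B"
    "span B = {W. \<forall>x\<in>S. blinfun_apply W x \<in> R}"
    "card B = DIM('a) * DIM('b) - dim S * (DIM('b) - dim R)"
proof -
  obtain X where X: "finite X" "pairwise orthogonal X" "\<And>x. x \<in> X \<Longrightarrow> norm x = 1"
    "span X = UNIV" "card X = DIM('a)" "card (X \<inter> S) = dim S"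
    "\<And>b x. b \<in> X - S \<Longrightarrow> x \<in> S \<Longrightarrow> x \<bullet> b = 0"
    using orthonormal_basis_adapted[OF S] by metis
  obtain Y where Y: "finite Y" "pairwise orthogonal Y" "\<And>x. x \<in> Y \<Longrightarrow> norm x = 1"
    "span Y = UNIV" "card Y = DIM('b)" "card (Y \<inter> R) = dim R"
    "\<And>b x. b \<in> Y - R \<Longrightarrow> x \<in> R \<Longrightarrow> x \<bullet> b = 0"
    using orthonormal_basis_adapted[OF R] by metis
  define r where "r = (\<lambda>(b::'a, c::'b). blinfun_scaleR_left c o\<^sub>L blinfun_inner_left b)"
  define I where "I = X \<times> Y - (X \<inter> S) \<times> (Y - R)"
  have r_apply: "r (b, c) v = (v \<bullet> b) *\<^sub>R c" for b c v
    by (simp add: r_def)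
  have dX: "b \<bullet> b' = (if b = b' then 1 else 0)" if "b \<in> X" "b' \<in> X" for b b'
    using that X(2) X(3)[of b] by (auto simp: pairwise_def orthogonal_def norm_eq_1)
  have dY: "b \<bullet> b' = (if b = b' then 1 else 0)" if "b \<in> Y" "b' \<in> Y" for b b'
    using that Y(2) Y(3)[of b] by (auto simp: pairwise_def orthogonal_def norm_eq_1)
  have entry: "blinfun_apply (r q) (fst p) \<bullet> snd p = (if p = q then 1 else 0)"
    if "p \<in> X \<times> Y" "q \<in> X \<times> Y" for p q
    using that by (cases p; cases q) (auto simp: r_apply dX dY)
  have inj: "inj_on r (X \<times> Y)"
    by (rule inj_onI) (metis entry zero_neq_one)
  have I: "finite I" "I \<subseteq> X \<times> Y"
    using X(1) Y(1) by (auto simp: I_def)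
  have inj_I: "inj_on r I"
    using inj I(2) inj_on_subset by blast
  have "independent (r ` I)"
  proof (rule independent_if_scalars_zero)
    fix f w assume sum0: "(\<Sum>w\<in>r ` I. f w *\<^sub>R w) = 0" and "w \<in> r ` I"
    then obtain p where p: "p \<in> I" "w = r p" by auto
    have "(\<Sum>q\<in>I. f (r q) *\<^sub>R r q) = 0"
      using sum0 by (simp add: sum.reindex[OF inj_I])
    then have "blinfun_apply (\<Sum>q\<in>I. f (r q) *\<^sub>R r q) (fst p) \<bullet> snd p = 0"
      by simp
    then have "0 = (\<Sum>q\<in>I. f (r q) * (blinfun_apply (r q) (fst p) \<bullet> snd p))"
      by (simp add: blinfun.bilinear_simps inner_sum_left)
    also have "\<dots> = (\<Sum>q\<in>I. if p = q then f (r q) else 0)"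
    proof (rule sum.cong)
      fix q assume "q \<in> I"
      then show "f (r q) * (blinfun_apply (r q) (fst p) \<bullet> snd p) = (if p = q then f (r q) else 0)"
        using I(2) p(1) entry[of p q] by (simp add: subset_eq)
    qed simp
    also have "\<dots> = f w"
      using I p by simp
    finally show "f w = 0" by simp
  qed (use I in simp)
  moreover have "span (r ` I) = {W. \<forall>x\<in>S. blinfun_apply W x \<in> R}" (is "_ = ?E")
  proof
    have "r p \<in> ?E" if p: "p \<in> I" for p
    proof (cases p)
      case (Pair b c)
      then consider "b \<in> X - S" | "c \<in> R" using p Pair by (auto simp: I_def)
      then show ?thesis
        by cases (auto simp: Pair r_apply X(7) subspace_0[OF R] intro: subspace_mul[OF R])
    qed
    moreover have "subspace ?E"
      unfolding subspace_def
      by (auto simp: blinfun.bilinear_simps intro: subspace_0[OF R] subspace_add[OF R] subspace_mul[OF R])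
    ultimately show "span (r ` I) \<subseteq> ?E"
      by (intro span_minimal) auto
    show "?E \<subseteq> span (r ` I)"
    proof
      fix W assume W: "W \<in> ?E"
      have "W = (\<Sum>p\<in>X \<times> Y. (blinfun_apply W (fst p) \<bullet> snd p) *\<^sub>R r p)"
      proof (rule blinfun_eqI)
        fix v
        have "W v = W (\<Sum>b\<in>X. (v \<bullet> b) *\<^sub>R b)"
          using orthonormal_basis_expand[OF X(2) X(3) _ X(1)] X(4) by simp
        also have "\<dots> = (\<Sum>b\<in>X. (v \<bullet> b) *\<^sub>R W b)"
          by (simp add: blinfun.bilinear_simps)
        also have "\<dots> = (\<Sum>b\<in>X. (v \<bullet> b) *\<^sub>R (\<Sum>c\<in>Y. (W b \<bullet> c) *\<^sub>R c))"
          using orthonormal_basis_expand[OF Y(2) Y(3) _ Y(1)] Y(4) by simp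
        also have "\<dots> = (\<Sum>b\<in>X. \<Sum>c\<in>Y. (W b \<bullet> c) *\<^sub>R r (b, c) v)"
          by (simp add: scaleR_sum_right r_apply mult.commute)
        also have "\<dots> = (\<Sum>p\<in>X \<times> Y. (W (fst p) \<bullet> snd p) *\<^sub>R r p v)"
          by (simp add: sum.cartesian_product split_def)
        finally show "W v = blinfun_apply (\<Sum>p\<in>X \<times> Y. (W (fst p) \<bullet> snd p) *\<^sub>R r p) v"
          by (simp add: blinfun.bilinear_simps)
      qed
      also have "\<dots> = (\<Sum>p\<in>I. (W (fst p) \<bullet> snd p) *\<^sub>R r p)"
      proof (rule sum.mono_neutral_right)
        show "\<forall>p\<in>X \<times> Y - I. (W (fst p) \<bullet> snd p) *\<^sub>R r p = 0"
          using W Y(7) by (auto simp: I_def)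
      qed (use X(1) Y(1) I in auto)
      finally show "W \<in> span (r ` I)"
        by (metis (no_types, lifting) imageI span_base span_mul span_sum)
    qed
  qed
  moreover have "card (r ` I) = DIM('a) * DIM('b) - dim S * (DIM('b) - dim R)"
  proof -
    have "card (Y - R) = DIM('b) - dim R"
      using card_Diff_subset_Int[of Y R] Y by simp
    moreover have "card I = card (X \<times> Y) - card ((X \<inter> S) \<times> (Y - R))"
      unfolding I_def using X(1) Y(1) by (intro card_Diff_subset) auto
    ultimately show ?thesis
      by (simp add: card_image[OF inj_I] card_cartesian_product X Y)
  qed
  ultimately show ?thesis
    using that I(1) by blast
qed

text \<open>
  Rank and nullity: \<open>T\<close> is injective on the orthogonal complement \<open>V\<close> of its kernel, and it maps
  \<open>V\<close> onto its range.
\<close>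

lemma dim_kernel_plus_op_rank:
  fixes T :: "'a::euclidean_space \<Rightarrow>\<^sub>L 'b::euclidean_space"
  shows "dim {x. T x = 0} + op_rank T = DIM('a)"
proof -
  define N where "N = {x. T x = 0}"
  define V where "V = {y. \<forall>x\<in>N. orthogonal x y}"
  have N: "subspace N"
    unfolding N_def by (rule linear_subspace_kernel[OF linear_blinfun_apply])
  have V: "subspace V"
    unfolding V_def by (rule subspace_orthogonal_to_vectors)
  have "inj_on T V"
  proof (rule inj_onI)
    fix x y assume "x \<in> V" "y \<in> V" "T x = T y"
    then have "x - y \<in> N" "x - y \<in> V"
      using subspace_diff[OF V] by (auto simp: N_def blinfun.bilinear_simps)
    then show "x = y" by (auto simp: V_def orthogonal_def)
  qed
  then have "dim (T ` V) = dim V"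
    using V by (intro dim_image_eq linear_blinfun_apply) (simp add: span_eq_iff[THEN iffD2])
  moreover have "T ` V = range T"
  proof (intro equalityI subsetI)
    fix y assume "y \<in> range T"
    then obtain x where x: "y = T x" by auto
    obtain u v where "u \<in> span N" "\<And>w. w \<in> span N \<Longrightarrow> orthogonal v w" "x = u + v"
      using orthogonal_subspace_decomp_exists[of N x] by metis
    moreover have "span N = N"
      using N by (rule span_eq_iff[THEN iffD2])
    ultimately have "v \<in> V" "T u = 0"
      by (auto simp: V_def orthogonal_commute) (simp add: N_def)
    then show "y \<in> T ` V"
      using x \<open>x = u + v\<close> by (auto simp: blinfun.bilinear_simps)
  qed auto
  ultimately show ?thesis
    using dim_subspace_orthogonal_to_vectors[OF N subspace_UNIV] 
    by (simp add: V_def op_rank_def N_def)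
qed

lemma kernel_to_range_basis:
  fixes T :: "'a::euclidean_space \<Rightarrow>\<^sub>L 'b::euclidean_space"
  obtains B where "finite B" "independent B" "kernel_to_range T = span B"
    "card B = (DIM('a) + DIM('b) - op_rank T) * op_rank T"
proof -
  have sub: "subspace {x. T x = 0}" "subspace (range T)"
    by (intro linear_subspace_kernel linear_subspace_image linear_blinfun_apply subspace_UNIV)+
  obtain B where B: "finite B" "independent B"
      "span B = {W. \<forall>x\<in>{x. T x = 0}. blinfun_apply W x \<in> range T}"
      "card B = DIM('a) * DIM('b) - dim {x. T x = 0} * (DIM('b) - dim (range T))"
    by (rule basis_of_operators_between_subspaces[OF sub])
  define a where "a = dim {x. T x = 0}"
  define b where "b = DIM('b) - op_rank T"
  have a: "DIM('a) = op_rank T + a"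
    using dim_kernel_plus_op_rank[of T] by (simp add: a_def)
  have b: "DIM('b) = op_rank T + b"
    using dim_subset_UNIV[of "range T"] by (simp add: b_def op_rank_def)
  have "card B = (op_rank T + a) * (op_rank T + b) - a * b"
    using B(4) unfolding a_def[symmetric] op_rank_def[symmetric] a b by simp
  also have "\<dots> = (DIM('a) + DIM('b) - op_rank T) * op_rank T"
    unfolding a b by (simp add: algebra_simps)
  finally have "card B = (DIM('a) + DIM('b) - op_rank T) * op_rank T" .
  then show ?thesis
    using that[OF B(1,2)] B(3) by (auto simp: kernel_to_range_def)
qed

theorem op_rank_slice_exists:
  fixes T :: "'a::euclidean_space \<Rightarrow>\<^sub>L 'b::euclidean_space"
  assumes "op_rank T = k"
  shows "\<exists>E. smooth_slice_at {S :: 'a \<Rightarrow>\<^sub>L 'b. op_rank S = k} T E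
           \<and> dim E = (DIM('a) + DIM('b) - k) * k"
proof -
  obtain B where B: "finite B" "independent B" "kernel_to_range T = span B"
    "card B = (DIM('a) + DIM('b) - op_rank T) * op_rank T"
    using kernel_to_range_basis by metis
  show ?thesis
    using smooth_slice_op_rank[OF B(1,3)] B assms
    by (intro exI[of _ "kernel_to_range T"]) (simp add: dim_eq_card_independent)
qed

section \<open>Paths of operators of constant rank\<close>

lemma op_rank_compose_left:
  assumes "inj (blinfun_apply H)"
  shows "op_rank (H o\<^sub>L T) = op_rank T"
proof -
  have "range (blinfun_apply (H o\<^sub>L T)) = H ` range T"
    by auto
  moreover have "dim (H ` range T) = dim (range T)"
    using assms by (intro dim_image_eq linear_blinfun_apply inj_on_subset[OF assms]) auto
  ultimately show ?thesis by (simp add: op_rank_def)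
qed

lemma op_rank_compose_right:
  assumes "surj (blinfun_apply G)"
  shows "op_rank (T o\<^sub>L G) = op_rank T"
proof -
  have "range (blinfun_apply (T o\<^sub>L G)) = T ` range G"
    by auto
  then show ?thesis using assms by (simp add: op_rank_def)
qed

lemma op_rank_cong_kernel:
  fixes S T :: "'a::euclidean_space \<Rightarrow>\<^sub>L 'b::euclidean_space"
  assumes "\<And>x. S x = 0 \<longleftrightarrow> T x = 0"
  shows "op_rank S = op_rank T"
  using dim_kernel_plus_op_rank[of S] dim_kernel_plus_op_rank[of T] assms by simp

lemma path_component_image:
  assumes "path_component S x y" "continuous_on S f" "f ` S \<subseteq> S'"
  shows "path_component S' (f x) (f y)"
proof -
  obtain p where p: "path p" "path_image p \<subseteq> S" "pathstart p = x" "pathfinish p = y"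
    using assms(1) by (auto simp: path_component_def)
  have "path (f \<circ> p)"
    using p(1,2) assms(2) by (intro path_continuous_image continuous_on_subset[OF assms(2)])
  moreover have "path_image (f \<circ> p) \<subseteq> S'"
    using p(2) assms(3) by (simp add: path_image_compose) blast
  moreover have "pathstart (f \<circ> p) = f x" "pathfinish (f \<circ> p) = f y"
    by (simp_all add: pathstart_compose pathfinish_compose p)
  ultimately show ?thesis
    unfolding path_component_def by blast
qed

lemma path_component_line:
  fixes x v :: "'a::real_normed_vector"
  assumes "\<And>t. x + t *\<^sub>R v \<in> S"
  shows "path_component S x (x + v)"
proof (rule path_component_linepath)
  have "(1 - u) *\<^sub>R x + u *\<^sub>R (x + v) = x + u *\<^sub>R v" for u
    by (simp add: algebra_simps)
  then show "closed_segment x (x + v) \<subseteq> S"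
    using assms by (auto simp: closed_segment_def)
qed

lemma vector_outside_subspace_and_hyperplane:
  fixes \<phi> :: "'a::euclidean_space"
  assumes "subspace R" "R \<noteq> UNIV" "\<phi> \<noteq> 0"
  obtains b where "b \<notin> R" "b \<bullet> \<phi> \<noteq> 0"
proof -
  obtain c where c: "c \<notin> R" using assms(2) by auto
  show ?thesis
  proof (cases "c \<bullet> \<phi> = 0 \<and> \<phi> \<in> R")
    case True
    then have "c + \<phi> \<notin> R"
      using c subspace_diff[OF assms(1), of "c + \<phi>" \<phi>] by auto
    then show ?thesis
      using that[of "c + \<phi>"] True assms(3) by (simp add: inner_add_left)
  next
    case False
    then show ?thesis
      using that[of c] that[of \<phi>] c assms(3) by auto
  qed
qed

text \<open>
  The vector \<open>c\<close> lies neither in the range of \<open>T\<close> nor in the hyperplane orthogonal to \<open>\<phi>\<close>. Moving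
  along \<open>T + t R\<close>, where \<open>R\<close> takes values in the line through \<open>c\<close>, never enlarges the kernel since
  \<open>c\<close> is not in the range of \<open>T\<close>. At \<open>t = 1\<close> the range has been pushed along \<open>c\<close> into the
  hyperplane that \<open>H\<close> fixes, so the paths from \<open>T\<close> and from \<open>H T\<close> end at the same operator.
\<close>

lemma path_component_compose_left_elementary:
  fixes T :: "'a::euclidean_space \<Rightarrow>\<^sub>L 'b::euclidean_space"
  assumes k: "op_rank T = k" "k < DIM('b)"
    and H: "inj (blinfun_apply H)" "\<And>y. y \<bullet> \<phi> = 0 \<Longrightarrow> H y = y"
  shows "path_component {T. op_rank T = k} (H o\<^sub>L T) T"
proof (cases "\<phi> = 0")
  case True
  then have "H o\<^sub>L T = T"
    using H(2) by (intro blinfun_eqI) simp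
  then show ?thesis using k by (simp add: path_component_refl)
next
  case False
  have sub: "subspace (range T)"
    by (intro linear_subspace_image linear_blinfun_apply subspace_UNIV)
  have "range T \<noteq> UNIV"
    using k by (auto simp: op_rank_def dim_UNIV)
  then obtain c where c: "c \<notin> range T" "c \<bullet> \<phi> \<noteq> 0"
    using vector_outside_subspace_and_hyperplane[OF sub _ False] by metis
  define R where "R = (blinfun_scaleR_left (- inverse (c \<bullet> \<phi>) *\<^sub>R c) o\<^sub>L blinfun_inner_left \<phi>) o\<^sub>L T"
  have R: "R x = (- (T x \<bullet> \<phi>) / (c \<bullet> \<phi>)) *\<^sub>R c" for x
    by (simp add: R_def field_simps)
  have "T + t *\<^sub>R R \<in> {T. op_rank T = k}" for t
  proof -
    have "(T + t *\<^sub>R R) x = 0 \<longleftrightarrow> T x = 0" for x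
    proof
      assume "(T + t *\<^sub>R R) x = 0"
      then have eq: "T x = (t * (T x \<bullet> \<phi>) / (c \<bullet> \<phi>)) *\<^sub>R c"
        by (simp add: blinfun.bilinear_simps R add_eq_0_iff2)
      have "t * (T x \<bullet> \<phi>) / (c \<bullet> \<phi>) = 0"
      proof (rule ccontr)
        assume s: "t * (T x \<bullet> \<phi>) / (c \<bullet> \<phi>) \<noteq> 0"
        define s' where "s' = t * (T x \<bullet> \<phi>) / (c \<bullet> \<phi>)"
        have "c = T ((1 / s') *\<^sub>R x)"
          using eq s unfolding s'_def[symmetric] by (simp add: blinfun.bilinear_simps)
        then show False using c(1) by blast
      qed
      then show "T x = 0" by (subst eq) simp
    qed (simp add: blinfun.bilinear_simps R)
    then show ?thesis using op_rank_cong_kernel[of "T + t *\<^sub>R R" T] k by simp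
  qed
  then have path: "path_component {T. op_rank T = k} T (T + R)"
    by (rule path_component_line)
  have "(T + R) x \<bullet> \<phi> = 0" for x
    using c(2) by (simp add: blinfun.bilinear_simps R inner_diff_left)
  then have fixed: "H o\<^sub>L (T + R) = T + R"
    using H(2) by (intro blinfun_eqI) simp
  have "path_component {T. op_rank T = k} (H o\<^sub>L T) (H o\<^sub>L (T + R))"
    using op_rank_compose_left[OF H(1)]
    by (intro path_component_image[OF path, of "\<lambda>T. H o\<^sub>L T"])
      (auto intro!: bounded_linear.continuous_on[OF
          bounded_bilinear.bounded_linear_right[OF bounded_bilinear_blinfun_compose]] continuous_intros)
  then show ?thesis
    unfolding fixed using path path_component_sym path_component_trans by blast
qed

text \<open>
  The dual device. Here \<open>G\<close> moves points only along \<open>a\<close>, so \<open>T\<close> has to be moved until it kills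
  \<open>a\<close>. The path subtracts from \<open>T\<close> a multiple of \<open>\<psi>\<close> times \<open>T a\<close>. As \<open>\<psi>\<close> does not vanish on the
  kernel vector \<open>w\<close>, each \<open>T x\<close> is attained at a point where \<open>\<psi>\<close> vanishes, so the range of \<open>T\<close>
  stays the same throughout.
\<close>

lemma path_component_compose_right_elementary:
  fixes T :: "'a::euclidean_space \<Rightarrow>\<^sub>L 'b::euclidean_space"
  assumes k: "op_rank T = k" "k < DIM('a)"
    and G: "surj (blinfun_apply G)" "\<And>x. \<exists>s. G x = x + s *\<^sub>R a"
  shows "path_component {T. op_rank T = k} (T o\<^sub>L G) T"
proof (cases "a = 0")
  case True
  then have "G x = x" for x
    using G(2)[of x] by simp
  then have "T o\<^sub>L G = T"
    by (intro blinfun_eqI) simp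
  then show ?thesis using k by (simp add: path_component_refl)
next
  case False
  have "dim {x. T x = 0} \<noteq> 0"
    using dim_kernel_plus_op_rank[of T] k by linarith
  then have "\<not> {x. T x = 0} \<subseteq> {0}"
    unfolding dim_eq_0 .
  then obtain w where w: "T w = 0" "w \<noteq> 0"
    by blast
  have "w \<notin> {x. w \<bullet> x = 0}"
    using w(2) by simp
  then have "{x. w \<bullet> x = 0} \<noteq> UNIV"
    by blast
  then obtain \<psi> where "\<psi> \<notin> {x. w \<bullet> x = 0}" and \<psi>a: "\<psi> \<bullet> a \<noteq> 0"
    using vector_outside_subspace_and_hyperplane[OF subspace_hyperplane _ False] by blast
  then have \<psi>: "\<psi> \<bullet> w \<noteq> 0" "\<psi> \<bullet> a \<noteq> 0"
    by (simp_all add: inner_commute)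
  define R where "R = T o\<^sub>L (blinfun_scaleR_left (- inverse (\<psi> \<bullet> a) *\<^sub>R a) o\<^sub>L blinfun_inner_left \<psi>)"
  have R: "R x = (- (x \<bullet> \<psi>) / (\<psi> \<bullet> a)) *\<^sub>R T a" for x
    by (simp add: R_def blinfun.bilinear_simps field_simps)
  have "T + t *\<^sub>R R \<in> {T. op_rank T = k}" for t
  proof -
    have "range (T + t *\<^sub>R R) = range T"
    proof (intro equalityI subsetI)
      fix y assume "y \<in> range (T + t *\<^sub>R R)"
      then obtain x where "y = (T + t *\<^sub>R R) x" by auto
      then have "y = T (x + (t * (- (x \<bullet> \<psi>) / (\<psi> \<bullet> a))) *\<^sub>R a)"
        by (simp add: blinfun.bilinear_simps R)
      then show "y \<in> range T" by blast
    next
      fix y assume "y \<in> range T"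
      then obtain x where x: "y = T x" by auto
      define z where "z = x - ((x \<bullet> \<psi>) / (\<psi> \<bullet> w)) *\<^sub>R w"
      have "z \<bullet> \<psi> = 0"
        using \<psi>(1) by (simp add: z_def inner_diff_left inner_diff_right inner_commute)
      then have "(T + t *\<^sub>R R) z = y"
        by (simp add: blinfun.bilinear_simps R) (simp add: z_def blinfun.bilinear_simps w x)
      then show "y \<in> range (T + t *\<^sub>R R)" by blast
    qed
    then show ?thesis using k by (simp add: op_rank_def)
  qed
  then have path: "path_component {T. op_rank T = k} T (T + R)"
    by (rule path_component_line)
  have kill: "(T + R) a = 0"
    using \<psi>(2) by (simp add: blinfun.bilinear_simps R inner_commute)
  have fixed: "(T + R) o\<^sub>L G = T + R"
  proof (rule blinfun_eqI)
    fix x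
    obtain s where "G x = x + s *\<^sub>R a" using G(2) by blast
    then show "((T + R) o\<^sub>L G) x = (T + R) x"
      using kill by (simp add: blinfun.add_right blinfun.scaleR_right)
  qed
  have "path_component {T. op_rank T = k} (T o\<^sub>L G) ((T + R) o\<^sub>L G)"
    using op_rank_compose_right[OF G(1)]
    by (intro path_component_image[OF path, of "\<lambda>T. T o\<^sub>L G"])
      (auto intro!: bounded_linear.continuous_on[OF
          bounded_bilinear.bounded_linear_left[OF bounded_bilinear_blinfun_compose]] continuous_intros)
  then show ?thesis
    unfolding fixed using path path_component_sym path_component_trans by blast
qed

text \<open>
  Gaussian elimination for invertible maps, with all generators of the single form
  \<open>x \<mapsto> x + (x \<bullet> \<phi>) a\<close>. Row swaps are reflections in \<open>axis m 1 - axis n 1\<close>, row additions are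
  transvections, and a diagonal map is multiplied together one coordinate at a time.
\<close>

lemma induct_linear_inj_elementary:
  fixes f :: "real^'n::finite \<Rightarrow> real^'n"
  assumes "linear f" "inj f"
    and comp: "\<And>f g. \<lbrakk>linear f; inj f; linear g; inj g; P f; P g\<rbrakk> \<Longrightarrow> P (f \<circ> g)"
    and elem: "\<And>\<phi> a. inj (\<lambda>x. x + (x \<bullet> \<phi>) *\<^sub>R a) \<Longrightarrow> P (\<lambda>x. x + (x \<bullet> \<phi>) *\<^sub>R a)"
  shows "P f"
proof -
  have coord: "x \<bullet> axis i 1 = x $ i" for x :: "real^'n" and i
    by (simp add: cart_eq_inner_axis)
  have "inj f \<longrightarrow> P f"
    using assms(1)
  proof (rule induct_linear_elementary)
    fix f g :: "real^'n \<Rightarrow> real^'n"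
    assume lin: "linear f" "linear g" and P: "inj f \<longrightarrow> P f" "inj g \<longrightarrow> P g"
    show "inj (f \<circ> g) \<longrightarrow> P (f \<circ> g)"
    proof
      assume fg: "inj (f \<circ> g)"
      then have g: "inj g" by (rule inj_on_imageI2)
      then have "surj g" using lin(2) linear_injective_imp_surjective by blast
      then have "inj f" using fg by (metis comp_inj_on_iff g)
      then show "P (f \<circ> g)" using comp lin P g by blast
    qed
  next
    fix f :: "real^'n \<Rightarrow> real^'n" and i
    assume f: "linear f" "\<And>x. f x $ i = 0"
    have "\<not> surj f"
      using f(2) by (metis axis_nth surj_def zero_neq_one)
    then show "inj f \<longrightarrow> P f"
      using f(1) linear_injective_imp_surjective by blast
  next
    fix c :: "'n \<Rightarrow> real"
    show "inj (\<lambda>x. \<chi> i. c i * x $ i) \<longrightarrow> P (\<lambda>x. \<chi> i. c i * x $ i)"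
    proof
      assume inj: "inj (\<lambda>x. (\<chi> i. c i * x $ i) :: real^'n)"
      have c: "c i \<noteq> 0" for i
      proof
        assume "c i = 0"
        then have "(\<chi> j. c j * axis i 1 $ j) = (\<chi> j. c j * (0 :: real^'n) $ j)"
          by (auto simp: vec_eq_iff axis_def)
        then have "axis i (1::real) = 0" using injD[OF inj] by blast
        then show False by simp
      qed
      \<comment> \<open>the diagonal map with the entries outside \<open>S\<close> replaced by 1\<close>
      define d where "d S = (\<lambda>x::real^'n. \<chi> i. if i \<in> S then c i * x $ i else x $ i)" for S
      have lin: "linear (d S)" for S
        by (auto simp: d_def linear_iff vec_eq_iff algebra_simps)
      have inj_d: "inj (d S)" for S
        using c by (auto simp: d_def inj_def vec_eq_iff split: if_splits)
      have "P (d S)" for S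
        using finite[of S]
      proof induction
        case empty
        then show ?case using elem[of 0 0] by (simp add: d_def)
      next
        case (insert i S)
        have eq: "d {i} = (\<lambda>x. x + (x \<bullet> axis i 1) *\<^sub>R ((c i - 1) *\<^sub>R axis i 1))"
          unfolding coord by (auto simp: d_def fun_eq_iff vec_eq_iff axis_def algebra_simps)
        have "P (d {i})"
          using elem inj_d[of "{i}"] unfolding eq by blast
        then have "P (d {i} \<circ> d S)"
          by (rule comp[OF lin inj_d lin inj_d _ insert.IH])
        moreover have "d (insert i S) = d {i} \<circ> d S"
          using insert.hyps by (auto simp: d_def fun_eq_iff vec_eq_iff)
        ultimately show ?case
          by (simp only:)
      qed
      from this[of UNIV] show "P (\<lambda>x. \<chi> i. c i * x $ i)" by (simp add: d_def)
    qed
  next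
    fix m n :: 'n assume "m \<noteq> n"
    have "(\<lambda>x::real^'n. \<chi> i. x $ Transposition.transpose m n i)
          = (\<lambda>x. x + (x \<bullet> (axis m 1 - axis n 1)) *\<^sub>R (axis n 1 - axis m 1))"
      using \<open>m \<noteq> n\<close>
      unfolding inner_diff_right coord
      by (auto simp: fun_eq_iff vec_eq_iff axis_def Transposition.transpose_def)
    then show "inj (\<lambda>x::real^'n. \<chi> i. x $ Transposition.transpose m n i) \<longrightarrow>
               P (\<lambda>x. \<chi> i. x $ Transposition.transpose m n i)"
      using elem by simp
  next
    fix m n :: 'n assume "m \<noteq> n"
    have "(\<lambda>x::real^'n. \<chi> i. if i = m then x $ m + x $ n else x $ i)
          = (\<lambda>x. x + (x \<bullet> axis n 1) *\<^sub>R axis m 1)"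
      unfolding coord by (auto simp: fun_eq_iff vec_eq_iff axis_def)
    then show "inj (\<lambda>x::real^'n. \<chi> i. if i = m then x $ m + x $ n else x $ i) \<longrightarrow>
               P (\<lambda>x. \<chi> i. if i = m then x $ m + x $ n else x $ i)"
      using elem by simp
  qed
  then show ?thesis using assms(2) by blast
qed

lemma Blinfun_compose:
  fixes f g :: "'a::euclidean_space \<Rightarrow> 'a"
  assumes "linear f" "linear g"
  shows "Blinfun (f \<circ> g) = Blinfun f o\<^sub>L Blinfun g"
  using assms
  by (intro blinfun_eqI) (simp add: blinfun_apply_Blinfun_linear linear_compose)

lemma linear_elementary: "linear (\<lambda>x. x + (x \<bullet> \<phi>) *\<^sub>R a)"
  by (auto simp: linear_iff algebra_simps inner_add_left)

lemma path_component_compose_left: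
  fixes T :: "'a::euclidean_space \<Rightarrow>\<^sub>L (real^'n::finite)"
  assumes k: "op_rank T = k" "k < CARD('n)" and f: "linear f" "inj f"
  shows "path_component {T. op_rank T = k} (Blinfun f o\<^sub>L T) T"
proof -
  have "\<forall>T::'a \<Rightarrow>\<^sub>L (real^'n). op_rank T = k \<longrightarrow> path_component {T. op_rank T = k} (Blinfun f o\<^sub>L T) T"
    using f
  proof (rule induct_linear_inj_elementary; intro allI impI)
    fix f g :: "real^'n \<Rightarrow> real^'n" and T :: "'a \<Rightarrow>\<^sub>L (real^'n)"
    assume fg: "linear f" "linear g" "inj g"
      and f: "\<forall>T::'a \<Rightarrow>\<^sub>L (real^'n). op_rank T = k \<longrightarrow> path_component {T. op_rank T = k} (Blinfun f o\<^sub>L T) T"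
      and g: "\<forall>T::'a \<Rightarrow>\<^sub>L (real^'n). op_rank T = k \<longrightarrow> path_component {T. op_rank T = k} (Blinfun g o\<^sub>L T) T"
      and T: "op_rank T = k"
    have "op_rank (Blinfun g o\<^sub>L T) = k"
      using T fg by (simp add: op_rank_compose_left blinfun_apply_Blinfun_linear)
    moreover have "Blinfun (f \<circ> g) o\<^sub>L T = Blinfun f o\<^sub>L (Blinfun g o\<^sub>L T)"
      by (rule blinfun_eqI) (simp add: Blinfun_compose fg)
    ultimately show "path_component {T. op_rank T = k} (Blinfun (f \<circ> g) o\<^sub>L T) T"
      using path_component_trans[OF f[rule_format] g[rule_format, OF T]] by simp
  next
    fix \<phi> a :: "real^'n" and T :: "'a \<Rightarrow>\<^sub>L (real^'n)"
    assume "inj (\<lambda>x. x + (x \<bullet> \<phi>) *\<^sub>R a)" "op_rank T = k"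
    then show "path_component {T. op_rank T = k} (Blinfun (\<lambda>x. x + (x \<bullet> \<phi>) *\<^sub>R a) o\<^sub>L T) T"
      using k(2) by (intro path_component_compose_left_elementary[where \<phi> = \<phi>])
        (simp_all add: blinfun_apply_Blinfun_linear[OF linear_elementary])
  qed
  then show ?thesis using k(1) by blast
qed

lemma path_component_compose_right:
  fixes T :: "(real^'m::finite) \<Rightarrow>\<^sub>L 'b::euclidean_space"
  assumes k: "op_rank T = k" "k < CARD('m)" and f: "linear f" "inj f"
  shows "path_component {T. op_rank T = k} (T o\<^sub>L Blinfun f) T"
proof -
  have "\<forall>T::(real^'m) \<Rightarrow>\<^sub>L 'b. op_rank T = k \<longrightarrow> path_component {T. op_rank T = k} (T o\<^sub>L Blinfun f) T"
    using f
  proof (rule induct_linear_inj_elementary; intro allI impI)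
    fix f g :: "real^'m \<Rightarrow> real^'m" and T :: "(real^'m) \<Rightarrow>\<^sub>L 'b"
    assume fg: "linear f" "inj f" "linear g"
      and f: "\<forall>T::(real^'m) \<Rightarrow>\<^sub>L 'b. op_rank T = k \<longrightarrow> path_component {T. op_rank T = k} (T o\<^sub>L Blinfun f) T"
      and g: "\<forall>T::(real^'m) \<Rightarrow>\<^sub>L 'b. op_rank T = k \<longrightarrow> path_component {T. op_rank T = k} (T o\<^sub>L Blinfun g) T"
      and T: "op_rank T = k"
    have "surj f" using fg linear_injective_imp_surjective by blast
    then have "op_rank (T o\<^sub>L Blinfun f) = k"
      using T fg by (simp add: op_rank_compose_right blinfun_apply_Blinfun_linear)
    moreover have "T o\<^sub>L Blinfun (f \<circ> g) = (T o\<^sub>L Blinfun f) o\<^sub>L Blinfun g"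
      by (rule blinfun_eqI) (simp add: Blinfun_compose fg)
    ultimately show "path_component {T. op_rank T = k} (T o\<^sub>L Blinfun (f \<circ> g)) T"
      using path_component_trans[OF g[rule_format] f[rule_format, OF T]] by simp
  next
    fix \<phi> a :: "real^'m" and T :: "(real^'m) \<Rightarrow>\<^sub>L 'b"
    assume *: "inj (\<lambda>x. x + (x \<bullet> \<phi>) *\<^sub>R a)" "op_rank T = k"
    then have "surj (\<lambda>x. x + (x \<bullet> \<phi>) *\<^sub>R a)"
      using linear_injective_imp_surjective[OF linear_elementary] by blast
    then show "path_component {T. op_rank T = k} (T o\<^sub>L Blinfun (\<lambda>x. x + (x \<bullet> \<phi>) *\<^sub>R a)) T"
      using k(2) * by (intro path_component_compose_right_elementary[where a = a])
        (auto simp: blinfun_apply_Blinfun_linear[OF linear_elementary])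
  qed
  then show ?thesis using k(1) by blast
qed

lemma linear_projection_exists:
  fixes S :: "'a::euclidean_space set"
  assumes "subspace S"
  obtains p where "linear p" "range p = S" "\<And>x. x \<in> S \<Longrightarrow> p x = x"
proof -
  obtain p :: "'a \<Rightarrow> 'a" where p: "range p \<subseteq> S" "linear p" "\<forall>x\<in>S. p x = x"
    using linear_exists_left_inverse_on[OF linear_id assms] by auto
  have "S \<subseteq> range p"
  proof
    fix x assume "x \<in> S"
    then have "x = p x" using p(3) by simp
    then show "x \<in> range p" by blast
  qed
  then show ?thesis using that p by blast
qed

text \<open>
  Complete \<open>f\<close> on \<open>S\<close> by an isomorphism \<open>q\<close> between a complement of \<open>S\<close> and one of \<open>f ` S\<close>. Both
  complements are kernels of projections, so their dimensions agree.
\<close>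

lemma linear_inj_on_extension:
  fixes f :: "'a::euclidean_space \<Rightarrow> 'a"
  assumes f: "linear f" "subspace S" "inj_on f S"
  obtains F where "linear F" "inj F" "\<And>x. x \<in> S \<Longrightarrow> F x = f x"
proof -
  have proj: "\<exists>p. linear p \<and> range p = R \<and> (\<forall>v\<in>R. p v = v) \<and> dim {x. p x = 0} + dim R = DIM('a)"
    if R: "subspace R" for R :: "'a set"
  proof -
    obtain p :: "'a \<Rightarrow> 'a" where "linear p" "range p = R" "\<And>v. v \<in> R \<Longrightarrow> p v = v"
      using linear_projection_exists[OF R] by metis
    then show ?thesis
      using dim_kernel_plus_op_rank[of "Blinfun p"]
      by (auto simp: op_rank_def blinfun_apply_Blinfun_linear)
  qed
  have fS: "subspace (f ` S)"
    using f by (intro linear_subspace_image)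
  obtain p where p: "linear p" "range p = S" "\<And>v. v \<in> S \<Longrightarrow> p v = v" "dim {x. p x = 0} + dim S = DIM('a)"
    using proj[OF f(2)] by auto
  obtain p' where p': "linear p'" "range p' = f ` S" "\<And>v. v \<in> f ` S \<Longrightarrow> p' v = v"
      "dim {x. p' x = 0} + dim (f ` S) = DIM('a)"
    using proj[OF fS] by auto
  have "dim (f ` S) = dim S"
    using f by (intro dim_image_eq) (simp_all add: span_eq_iff[THEN iffD2])
  then have "dim {x. p x = 0} = dim {x. p' x = 0}"
    using p(4) p'(4) by simp
  then obtain q where q: "linear q" "q ` {x. p x = 0} = {x. p' x = 0}" "inj_on q {x. p x = 0}"
    using subspace_isomorphism[of "{x. p x = 0}" "{x. p' x = 0}"] p(1) p'(1) linear_subspace_kernel by blast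
  define F where "F x = f (p x) + q (x - p x)" for x
  have pp: "p (x - p x) = 0" for x
    using p(1-3) by (metis linear_diff rangeI right_minus_eq)
  have "linear F"
    unfolding F_def
    by (intro linear_compose_add linear_compose[OF p(1) f(1), unfolded o_def]
        linear_compose[OF linear_compose_sub[OF linear_ident p(1)] q(1), unfolded o_def])
  moreover have "inj F"
    unfolding linear_injective_0[OF \<open>linear F\<close>]
  proof (intro allI impI)
    fix x assume F0: "F x = 0"
    have "q (x - p x) \<in> {x. p' x = 0}"
      using q(2) pp by blast
    then have "p' (F x) = f (p x)"
      using p'(3)[of "f (p x)"] p(2) by (simp add: F_def linear_add[OF p'(1)] image_iff) blast
    then have "f (p x) = 0"
      using F0 linear_0[OF p'(1)] by simp
    then have "p x = 0"
      using inj_onD[OF f(3), of "p x" 0] p(2) subspace_0[OF f(2)] linear_0[OF f(1)] by auto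
    then have "q x = 0" "x \<in> {x. p x = 0}"
      using F0 linear_0[OF f(1)] by (auto simp: F_def)
    then show "x = 0"
      using inj_onD[OF q(3), of x 0] linear_0[OF q(1)] linear_0[OF p(1)] by auto
  qed
  moreover have "F x = f x" if "x \<in> S" for x
    using p(3)[OF that] linear_0[OF q(1)] by (simp add: F_def)
  ultimately show ?thesis using that by blast
qed

text \<open>
  First \<open>T\<close> is replaced by \<open>T' = T G\<close>, where \<open>G\<close> is invertible and maps the kernel of \<open>S\<close> onto that of
  \<open>T\<close>. Then \<open>S\<close> and \<open>T'\<close> have the same kernel, so \<open>S x \<mapsto> T' x\<close> is a well-defined injective map on
  the range of \<open>S\<close>; its invertible extension \<open>H\<close> satisfies \<open>H S = T'\<close>.
\<close>

theorem path_connected_op_rank: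
  assumes "k < CARD('m)" "k < CARD('n)"
  shows "path_connected {T :: (real^'m::finite) \<Rightarrow>\<^sub>L (real^'n::finite). op_rank T = k}"
  unfolding path_connected_component
proof (intro ballI)
  fix T S :: "(real^'m) \<Rightarrow>\<^sub>L (real^'n)"
  assume "T \<in> {T. op_rank T = k}" "S \<in> {T. op_rank T = k}"
  then have T: "op_rank T = k" and S: "op_rank S = k" by auto
  have ker: "subspace {x. T x = 0}" "subspace {x. S x = 0}"
    by (intro linear_subspace_kernel linear_blinfun_apply)+
  have "dim {x. S x = 0} = dim {x. T x = 0}"
    using dim_kernel_plus_op_rank[of T] dim_kernel_plus_op_rank[of S] T S by simp
  then obtain g where g: "linear g" "g ` {x. S x = 0} = {x. T x = 0}" "inj_on g {x. S x = 0}"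
    using subspace_isomorphism[OF ker(2,1)] by blast
  obtain G where G: "linear G" "inj G" "\<And>x. S x = 0 \<Longrightarrow> G x = g x"
    using linear_inj_on_extension[OF g(1) ker(2) g(3)] by auto
  define T' where "T' = T o\<^sub>L Blinfun G"
  have T'_apply: "T' x = T (G x)" for x
    by (simp add: T'_def blinfun_apply_Blinfun_linear[OF G(1)])
  have T'_T: "path_component {T. op_rank T = k} T' T"
    unfolding T'_def by (rule path_component_compose_right[OF T assms(1) G(1,2)])
  have ker': "T' x = 0 \<longleftrightarrow> S x = 0" for x
  proof -
    have "G ` {x. S x = 0} = {x. T x = 0}"
      using g(2) G(3) by (metis (mono_tags, lifting) image_cong mem_Collect_eq)
    then have "G x \<in> G ` {x. S x = 0} \<longleftrightarrow> T' x = 0"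
      by (simp add: T'_apply)
    then show ?thesis using inj_image_mem_iff[OF G(2)] by auto
  qed
  obtain A :: "(real^'n) \<Rightarrow>\<^sub>L (real^'m)" where A: "\<And>x. S (A (S x)) = S x"
    using generalized_inverse_exists by metis
  define h where "h = T' o\<^sub>L A"
  have h: "h (S x) = T' x" for x
  proof -
    have "T' (A (S x) - x) = 0"
      unfolding ker' by (simp add: blinfun.bilinear_simps A)
    then show ?thesis by (simp add: h_def blinfun.bilinear_simps)
  qed
  have "inj_on h (range S)"
  proof (rule inj_onI)
    fix y z assume "y \<in> range S" "z \<in> range S" and hyz: "h y = h z"
    then obtain u v where uv: "y = S u" "z = S v" by auto
    have "T' (u - v) = 0"
      using hyz by (simp add: uv h blinfun.bilinear_simps)
    then show "y = z"
      unfolding ker' by (simp add: uv blinfun.bilinear_simps)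
  qed
  moreover have "subspace (range S)"
    by (intro linear_subspace_image linear_blinfun_apply subspace_UNIV)
  ultimately obtain H where H: "linear H" "inj H" "\<And>y. y \<in> range S \<Longrightarrow> H y = h y"
    using linear_inj_on_extension[OF linear_blinfun_apply[of h]] by metis
  have "Blinfun H o\<^sub>L S = T'"
    by (rule blinfun_eqI) (simp add: blinfun_apply_Blinfun_linear[OF H(1)] H(3) h)
  then have "path_component {T. op_rank T = k} T' S"
    using path_component_compose_left[OF S assms(2) H(1,2)] by simp
  then show "path_component {T. op_rank T = k} T S"
    using T'_T path_component_sym path_component_trans by blast
qed

section \<open>The rank stratification\<close>

lemma op_rank_exists:
  assumes "k \<le> DIM('a)" "k \<le> DIM('b)"
  shows "\<exists>T :: 'a::euclidean_space \<Rightarrow>\<^sub>L 'b::euclidean_space. op_rank T = k"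
proof -
  obtain S :: "'a set" where S: "subspace S" "dim S = k"
    using choose_subspace_of_subspace[of k "UNIV :: 'a set"] assms by (auto simp: dim_UNIV)
  obtain R :: "'b set" where R: "subspace R" "dim R = k"
    using choose_subspace_of_subspace[of k "UNIV :: 'b set"] assms by (auto simp: dim_UNIV)
  obtain f where f: "linear f" "f ` S = R"
    using subspace_isomorphism[OF S(1) R(1) trans[OF S(2) R(2)[symmetric]]] by blast
  obtain p :: "'a \<Rightarrow> 'a" where p: "linear p" "range p = S"
    using linear_projection_exists[OF S(1)] by metis
  have "range (f \<circ> p) = R"
    unfolding image_comp[symmetric] p(2) f(2) ..
  moreover have "blinfun_apply (Blinfun (f \<circ> p)) = f \<circ> p"
    by (rule blinfun_apply_Blinfun_linear[OF linear_compose[OF p(1) f(1)]])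
  ultimately have "op_rank (Blinfun (f \<circ> p)) = k"
    by (simp only: op_rank_def R(2))
  then show ?thesis by blast
qed

theorem theorem3p2:
  shows "(UNIV :: ((real^'m::finite) \<Rightarrow>\<^sub>L (real^'n::finite)) set)
           = (\<Union>k\<in>{0..min CARD('n) CARD('m)}. fixed_rank k) \<and>
         (\<forall>k < min CARD('m) CARD('n).
            smooth_submanifold (fixed_rank k :: ((real^'m) \<Rightarrow>\<^sub>L (real^'n)) set) \<and>
            path_connected (fixed_rank k :: ((real^'m) \<Rightarrow>\<^sub>L (real^'n)) set)) \<and>
         (\<forall>k \<le> min CARD('n) CARD('m).
            has_manifold_dim (fixed_rank k :: ((real^'m) \<Rightarrow>\<^sub>L (real^'n)) set)
              ((CARD('m) + CARD('n) - k) * k))"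
proof (intro conjI allI impI)
  have "op_rank T \<le> min CARD('n) CARD('m)" for T :: "(real^'m) \<Rightarrow>\<^sub>L (real^'n)"
    using dim_subset_UNIV[of "range T"] dim_kernel_plus_op_rank[of T] by (simp add: op_rank_def)
  then show "(UNIV :: ((real^'m) \<Rightarrow>\<^sub>L (real^'n)) set)
           = (\<Union>k\<in>{0..min CARD('n) CARD('m)}. fixed_rank k)"
    by (auto simp: fixed_rank_def)
next
  fix k
  show "smooth_submanifold (fixed_rank k :: ((real^'m) \<Rightarrow>\<^sub>L (real^'n)) set)"
    using op_rank_slice_exists unfolding smooth_submanifold_def fixed_rank_def by blast
  assume "k < min CARD('m) CARD('n)"
  then show "path_connected (fixed_rank k :: ((real^'m) \<Rightarrow>\<^sub>L (real^'n)) set)"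
    by (simp add: fixed_rank_def path_connected_op_rank)
next
  fix k assume "k \<le> min CARD('n) CARD('m)"
  then have "(fixed_rank k :: ((real^'m) \<Rightarrow>\<^sub>L (real^'n)) set) \<noteq> {}"
    using op_rank_exists[where 'a = "real^'m" and 'b = "real^'n", of k] by (simp add: fixed_rank_def)
  moreover have "\<exists>E. smooth_slice_at (fixed_rank k) T E \<and> dim E = (CARD('m) + CARD('n) - k) * k"
    if "T \<in> fixed_rank k" for T :: "(real^'m) \<Rightarrow>\<^sub>L (real^'n)"
    using that op_rank_slice_exists[of T k] by (simp add: fixed_rank_def)
  ultimately show "has_manifold_dim (fixed_rank k :: ((real^'m) \<Rightarrow>\<^sub>L (real^'n)) set)
              ((CARD('m) + CARD('n) - k) * k)"
    by (simp add: has_manifold_dim_def)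
qed

end
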